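(* Every Hausdorff FSIN (functionally balanced) topological group $G$ is SIN (balanced). That is, if $G$ is a Hausdorff topological group such that every bounded real-valued left uniformly continuous function on $G$ is right uniformly continuous, then the left and right uniformities of $G$ coincide.
   Context: For a topological group $G$ with identity $e$, the left uniformity is generated by the sets $\{(x,y): x^{-1}y\in U\}$ and the right uniformity by the sets $\{(x,y): xy^{-1}\in U\}$, where $U$ ranges over the neighbourhoods of $e$. A function $G\to\mathbb R$ is left (right) uniformly continuous if it is uniformly continuous with respect to the left (right) uniformity and the usual uniformity on $\mathbb R$. $G$ is balanced, or SIN, if the left and right uniformities coincide (equivalently, every identity neighbourhood contains an identity neighbourhood invariant under all inner automorphisms). $G$ is functionally balanced, or FSIN, if every bounded real-valued left uniformly continuous function on $G$ is right uniformly continuous. *)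

theory Defs
  imports "HOL-Analysis.Analysis"
begin

text \<open>
  Topological groups are the types of class \<open>topological_group_add\<close>.  Despite the additive notation,
  this class does not assume commutativity: \<open>x + y\<close>, \<open>0\<close> and \<open>- x\<close> stand for
  \<open>xy\<close>, \<open>e\<close> and \<open>x\<^sup>-\<^sup>1\<close>, so \<open>- x + y\<close> is \<open>x\<^sup>-\<^sup>1y\<close> and \<open>x - y\<close> is \<open>xy\<^sup>-\<^sup>1\<close>.
  Since one group carries two uniformities, these are given as filters on pairs,
  not through the class \<open>uniform_space\<close>.  In the generating families, \<open>U\<close> is a (not necessarily open)
  neighbourhood of \<open>0\<close>.
\<close>

definition left_uniformity :: "('a::topological_group_add \<times> 'a) filter"
  where "left_uniformity =
    (INF U \<in> {U. \<forall>\<^sub>F u in nhds 0. u \<in> U}. principal {(x, y). - x + y \<in> U})"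

definition right_uniformity :: "('a::topological_group_add \<times> 'a) filter"
  where "right_uniformity =
    (INF U \<in> {U. \<forall>\<^sub>F u in nhds 0. u \<in> U}. principal {(x, y). x - y \<in> U})"

text \<open>As in \<open>uniformly_continuous_on_uniformity\<close>, with an explicit uniformity on the domain.\<close>

definition uniformly_continuous_wrt :: "('a \<times> 'a) filter \<Rightarrow> ('a \<Rightarrow> 'b::uniform_space) \<Rightarrow> bool"
  where "uniformly_continuous_wrt \<U> f \<longleftrightarrow> (LIM (x, y) \<U>. (f x, f y) :> uniformity)"

definition SIN :: "'a::topological_group_add itself \<Rightarrow> bool"
  where "SIN _ \<longleftrightarrow> (left_uniformity :: ('a \<times> 'a) filter) = right_uniformity"

definition FSIN :: "'a::topological_group_add itself \<Rightarrow> bool"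
  where "FSIN _ \<longleftrightarrow> (\<forall>f :: 'a \<Rightarrow> real.
    bounded (range f) \<and> uniformly_continuous_wrt left_uniformity f
      \<longrightarrow> uniformly_continuous_wrt right_uniformity f)"

text \<open>The sets \<open>{(x, y). - x + y \<in> U}\<close> and \<open>{(x, y). x - y \<in> U}\<close> form bases, not just subbases.\<close>

lemma eventually_INF_principal_nhds:
  "eventually P (INF U \<in> {U. \<forall>\<^sub>F u in nhds (a::'b::topological_space). u \<in> U}. principal {p. g p \<in> U})
    \<longleftrightarrow> (\<exists>U. (\<forall>\<^sub>F u in nhds a. u \<in> U) \<and> (\<forall>p. g p \<in> U \<longrightarrow> P p))"
proof (subst eventually_INF_base)
  show "{U. \<forall>\<^sub>F u in nhds a. u \<in> U} \<noteq> {}"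
    by (auto intro!: exI[of _ UNIV])
  show "\<exists>W\<in>{U. \<forall>\<^sub>F u in nhds a. u \<in> U}.
      principal {p. g p \<in> W} \<le> inf (principal {p. g p \<in> U}) (principal {p. g p \<in> V})"
    if "U \<in> {U. \<forall>\<^sub>F u in nhds a. u \<in> U}" "V \<in> {U. \<forall>\<^sub>F u in nhds a. u \<in> U}" for U V
    using that by (intro bexI[of _ "U \<inter> V"]) (auto intro: eventually_conj)
qed (auto simp: eventually_principal)

lemma eventually_left_uniformity:
  "eventually P left_uniformity
    \<longleftrightarrow> (\<exists>U. (\<forall>\<^sub>F u in nhds 0. u \<in> U) \<and> (\<forall>x y. - x + y \<in> U \<longrightarrow> P (x, y)))"
  unfolding left_uniformity_def case_prod_unfold eventually_INF_principal_nhds by simp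

lemma eventually_right_uniformity:
  "eventually P right_uniformity
    \<longleftrightarrow> (\<exists>U. (\<forall>\<^sub>F u in nhds 0. u \<in> U) \<and> (\<forall>x y. x - y \<in> U \<longrightarrow> P (x, y)))"
  unfolding right_uniformity_def case_prod_unfold eventually_INF_principal_nhds by simp

end

theory Submission
  imports Defs
begin

text \<open>
  FSIN means that every \<open>A \<subseteq> G\<close> satisfies \<open>VA \<subseteq> AW\<close> for suitable \<open>V\<close>, given \<open>W\<close>.  Call \<open>D\<close> balanced if
  for each \<open>W\<close> some \<open>V\<close> satisfies \<open>d\<^sup>-\<^sup>1Vd \<subseteq> W\<close> for all \<open>d \<in> D\<close>; the claim is that \<open>G\<close> itself is balanced.
  Balanced sets are closed under subsets and products.  If the double cosets \<open>NeN\<close>, \<open>e \<in> E\<close>, are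
  separated from each other, then applying FSIN to the set of all \<open>p\<^sub>ee\<close>, with arbitrary small \<open>p\<^sub>e\<close>, shows
  that this set is balanced, and so are \<open>E\<close> and \<open>E\<^sup>-\<^sup>1\<close>.  Hence so are all \<open>p\<^sub>e = (p\<^sub>ee)e\<^sup>-\<^sup>1\<close>, and, writing \<open>G = PDP\<close>
  with \<open>D\<close> maximal separated, every set that injects into a separated set.

  Suppose \<open>G\<close> is not balanced and let \<open>B\<close> be a non-balanced set of least cardinality.  Then all
  separated sets are smaller than \<open>B\<close>, whereas some left uniformly discrete set \<open>M\<close> is at least as large as \<open>B\<close>.
  Let \<open>F\<close> be maximal separated for a small neighbourhood \<open>Q\<close>, and inject \<open>F\<close> into \<open>M\<close> by \<open>h\<close>.  Up to \<open>Q\<close>, a pair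
  \<open>(p, p')\<close> of elements of a neighbourhood \<open>P\<close> has the form \<open>(w, wf)\<close> with \<open>f \<in> F\<close>, and it is recovered from the
  single element \<open>wh(f)\<^sup>-\<^sup>1\<close> because the double cosets of the \<open>h(f)\<^sup>-\<^sup>1\<close> are distinct.  So FSIN makes every binary
  relation on \<open>P\<close> approximately invariant under left translation by some \<open>V\<close>.  Taking a well-order of a maximal
  discrete subset of \<open>P\<close>, which has no nontrivial automorphism, we see that \<open>V\<close> hardly moves any point of \<open>P\<close>;
  that is, \<open>P\<close> is balanced.  Then so is \<open>G = PDP\<close>, a contradiction.
\<close>

subsection \<open>Symmetric neighbourhoods and left uniformly continuous functions\<close>

definition sym_nbhd :: "'a::topological_group_add set \<Rightarrow> bool"
  where "sym_nbhd V \<longleftrightarrow> (\<forall>\<^sub>F u in nhds 0. u \<in> V) \<and> (\<forall>x\<in>V. - x \<in> V)"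

lemma sym_nbhdD:
  assumes "sym_nbhd V"
  shows "\<forall>\<^sub>F u in nhds 0. u \<in> V" "0 \<in> V" "x \<in> V \<Longrightarrow> - x \<in> V"
  using assms eventually_nhds_x_imp_x by (auto simp: sym_nbhd_def)

lemma sym_nbhd_Int: "sym_nbhd V \<Longrightarrow> sym_nbhd W \<Longrightarrow> sym_nbhd (V \<inter> W)"
  by (auto simp: sym_nbhd_def intro: eventually_conj)

lemma sym_nbhd_subset:
  assumes "\<forall>\<^sub>F u in nhds (0::'a::topological_group_add). u \<in> W"
  obtains V where "sym_nbhd V" "V \<subseteq> W"
proof
  have "LIM u nhds (0::'a). - u :> nhds (- 0)"
    by (rule tendsto_uminus_nhds)
  then have "\<forall>\<^sub>F u in nhds 0. - u \<in> W"
    using assms by (auto simp: filterlim_iff)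
  then show "sym_nbhd {u \<in> W. - u \<in> W}"
    using eventually_conj[OF assms] by (auto simp: sym_nbhd_def)
qed blast

text \<open>Continuity of addition at \<open>(0, 0)\<close>, used twice. Three summands are the form
  needed for conjugates and for the sets \<open>N + e + N\<close>.\<close>

lemma sym_nbhd_third:
  assumes "\<forall>\<^sub>F u in nhds (0::'a::topological_group_add). u \<in> W"
  obtains V where "sym_nbhd V" "\<And>x y z. \<lbrakk>x \<in> V; y \<in> V; z \<in> V\<rbrakk> \<Longrightarrow> x + y + z \<in> W"
proof -
  have half: "\<exists>V. (\<forall>\<^sub>F u in nhds 0. u \<in> V) \<and> (\<forall>x\<in>V. \<forall>y\<in>V. x + y \<in> W)"
    if "\<forall>\<^sub>F u in nhds 0. u \<in> W" for W :: "'a set"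
  proof -
    have "\<forall>\<^sub>F p in nhds (0::'a) \<times>\<^sub>F nhds 0. fst p + snd p \<in> W"
      using tendsto_add_Pair[of "0::'a" 0] that by (auto simp: filterlim_iff)
    then obtain P Q where "eventually P (nhds 0)" "eventually Q (nhds 0)"
      "\<And>x y. P x \<Longrightarrow> Q y \<Longrightarrow> x + y \<in> W"
      by (auto simp: eventually_prod_filter)
    then show ?thesis
      by (intro exI[of _ "{x. P x \<and> Q x}"]) (auto intro: eventually_conj)
  qed
  obtain V1 where V1: "\<forall>\<^sub>F u in nhds 0. u \<in> V1" "\<And>x y. x \<in> V1 \<Longrightarrow> y \<in> V1 \<Longrightarrow> x + y \<in> W"
    using half[OF assms] by blast
  obtain V2 where V2: "\<forall>\<^sub>F u in nhds 0. u \<in> V2" "\<And>x y. x \<in> V2 \<Longrightarrow> y \<in> V2 \<Longrightarrow> x + y \<in> V1"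
    using half[OF V1(1)] by blast
  obtain V where V: "sym_nbhd V" "V \<subseteq> V1 \<inter> V2"
    using sym_nbhd_subset[of "V1 \<inter> V2"] eventually_conj[OF V1(1) V2(1)] by auto
  show ?thesis
  proof
    show "x + y + z \<in> W" if "x \<in> V" "y \<in> V" "z \<in> V" for x y z
      using that V(2) by (intro V1(2) V2(2)) auto
  qed (fact V)
qed

lemma subset_if_third:
  assumes "sym_nbhd V" "\<And>x y z. \<lbrakk>x \<in> V; y \<in> V; z \<in> V\<rbrakk> \<Longrightarrow> x + y + z \<in> W"
  shows "V \<subseteq> W"
  using assms(2)[of _ 0 0] sym_nbhdD(2)[OF assms(1)] by auto

section \<open>Chains of neighbourhoods and Urysohn functions\<close>

text \<open>Cut at the first entry after which the remaining sum is below \<open>d\<close>. As long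
  as the remainder is at least \<open>d\<close>, the entries passed sum to less than
  \<open>c\<close>.\<close>

lemma sum_list_split:
  fixes xs :: "real list"
  assumes "\<forall>x\<in>set xs. 0 \<le> x" "xs \<noteq> []" "sum_list xs < c + d" "0 < c" "0 < d"
  shows "\<exists>as x bs. xs = as @ x # bs \<and> sum_list as < c \<and> sum_list bs < d"
  using assms
proof (induction xs arbitrary: c)
  case (Cons x xs)
  show ?case
  proof (cases "sum_list xs < d")
    case True
    then show ?thesis
      using Cons.prems by (intro exI[of _ "[]"]) auto
  next
    case False
    then have "xs \<noteq> []" "sum_list xs < (c - x) + d" "0 < c - x"
      using Cons.prems by auto
    then obtain as y bs where "xs = as @ y # bs" "sum_list as < c - x" "sum_list bs < d"
      using Cons.IH Cons.prems by (metis list.set_intros(2))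
    then show ?thesis
      by (intro exI[of _ "x # as"] exI[of _ y] exI[of _ bs]) auto
  qed
qed simp

text \<open>A word is a list of letters \<open>(k, u)\<close>, with \<open>u\<close> meant to lie in
  the \<open>k\<close>-th set of a chain of neighbourhoods; such a letter costs
  \<open>(1/2)^k\<close>.\<close>

definition weight :: "(nat \<times> 'a) list \<Rightarrow> real"
  where "weight ws = (\<Sum>k\<leftarrow>map fst ws. (1/2)^k)"

lemma weight_simps [simp]:
  "weight [] = 0" "weight (w # ws) = (1/2)^(fst w) + weight ws" "weight (us @ ws) = weight us + weight ws"
  by (simp_all add: weight_def)

lemma weight_nonneg: "0 \<le> weight ws"
  by (induction ws) auto

text \<open>The chain argument of the Birkhoff-Kakutani theorem. Cut the word at a letter into outer
  words of weight below \<open>(1/2)^Suc n\<close>, which induction puts into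
  \<open>U (Suc n)\<close>. The middle letter costs less than \<open>(1/2)^n\<close>, so its level
  is at least \<open>Suc n\<close>, and \<open>third\<close> applies.\<close>

lemma word_mem:
  fixes U :: "nat \<Rightarrow> 'a::topological_group_add set"
  assumes U: "\<And>n. sym_nbhd (U n)"
    and third: "\<And>n x y z. \<lbrakk>x \<in> U (Suc n); y \<in> U (Suc n); z \<in> U (Suc n)\<rbrakk> \<Longrightarrow> x + y + z \<in> U n"
  shows "\<lbrakk>\<forall>(k, u)\<in>set ws. u \<in> U k; weight ws < (1/2)^n\<rbrakk> \<Longrightarrow> sum_list (map snd ws) \<in> U n"
proof (induction "length ws" arbitrary: ws n rule: less_induct)
  case less
  have anti: "U (Suc n) \<subseteq> U n" for n
    using third[of _ n 0 0] sym_nbhdD(2)[OF U] by auto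
  show ?case
  proof (cases "ws = []")
    case True
    then show ?thesis
      by (simp add: sym_nbhdD(2)[OF U])
  next
    case False
    let ?xs = "map (\<lambda>w. (1/2)^(fst w) :: real) ws"
    have w: "weight vs = sum_list (map (\<lambda>w. (1/2)^(fst w)) vs)" for vs :: "(nat \<times> 'a) list"
      by (simp add: weight_def o_def)
    have "\<exists>as x bs. ?xs = as @ x # bs \<and> sum_list as < (1/2)^Suc n \<and> sum_list bs < (1/2)^Suc n"
      using less.prems(2) False by (intro sum_list_split) (auto simp: w)
    then obtain as k u bs where ws: "ws = as @ (k, u) # bs"
      and "weight as < (1/2)^Suc n" "weight bs < (1/2)^Suc n"
      by (auto simp: map_eq_append_conv map_eq_Cons_conv w)
    then have "sum_list (map snd as) \<in> U (Suc n)" "sum_list (map snd bs) \<in> U (Suc n)"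
      using less.prems(1) less.hyps by auto
    moreover have "u \<in> U (Suc n)"
    proof -
      have "(1/2)^k < (1/2::real)^n"
        using less.prems(2) weight_nonneg[of as] weight_nonneg[of bs]
        unfolding ws weight_simps fst_conv by linarith
      then have "Suc n \<le> k"
        by simp
      then have "U k \<subseteq> U (Suc n)"
        using lift_Suc_antimono_le[of U, OF anti] by blast
      then show ?thesis
        using less.prems(1) by (auto simp: ws)
    qed
    ultimately show ?thesis
      using third by (simp add: ws add.assoc[symmetric])
  qed
qed

text \<open>\<open>f x\<close> is the infimal cost, capped at 1, of reaching \<open>x\<close> from
  \<open>A\<close> by adding letters on the right. A further letter from \<open>U n\<close> raises
  it by at most \<open>(1/2)^n\<close>, whence left uniform continuity; a word of cost below 1 has
  its sum in \<open>U 0\<close>, hence in \<open>W\<close>.\<close>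

lemma left_uniform_Urysohn:
  fixes A W :: "'a::topological_group_add set"
  assumes W: "\<forall>\<^sub>F u in nhds 0. u \<in> W"
  obtains f :: "'a \<Rightarrow> real" where "bounded (range f)" "uniformly_continuous_wrt left_uniformity f"
    "\<And>a. a \<in> A \<Longrightarrow> f a = 0" "\<And>x. f x < 1 \<Longrightarrow> \<exists>a\<in>A. - a + x \<in> W"
proof -
  have "\<exists>U. sym_nbhd (U 0) \<and> U 0 \<subseteq> W \<and> (\<forall>n. sym_nbhd (U (Suc n)) \<and>
      (\<forall>x\<in>U (Suc n). \<forall>y\<in>U (Suc n). \<forall>z\<in>U (Suc n). x + y + z \<in> U n))"
  proof -
    obtain U0 where U0: "sym_nbhd U0" "U0 \<subseteq> W"
      using sym_nbhd_subset[OF W] .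
    have "\<exists>U. \<forall>n. (sym_nbhd (U n) \<and> U n \<subseteq> W) \<and> 
      (\<forall>x\<in>U (Suc n). \<forall>y\<in>U (Suc n). \<forall>z\<in>U (Suc n). x + y + z \<in> U n)"
    proof (rule dependent_nat_choice)
      show "\<exists>V. (sym_nbhd V \<and> V \<subseteq> W) \<and> (\<forall>x\<in>V. \<forall>y\<in>V. \<forall>z\<in>V. x + y + z \<in> U)"
        if "sym_nbhd U \<and> U \<subseteq> W" for U and n :: nat
      proof -
        have U: "sym_nbhd U" "U \<subseteq> W"
          using that by auto
        obtain V where V: "sym_nbhd V" "\<And>x y z. \<lbrakk>x \<in> V; y \<in> V; z \<in> V\<rbrakk> \<Longrightarrow> x + y + z \<in> U"
          using sym_nbhd_third[OF sym_nbhdD(1)[OF U(1)]] by blast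
        have "V \<subseteq> W"
          using subset_if_third[OF V] U(2) by blast
        then show ?thesis
          using V by blast
      qed
    qed (use U0 in blast)
    then show ?thesis
      by blast
  qed
  then obtain U where U: "\<And>n. sym_nbhd (U n)" "U 0 \<subseteq> W"
    and third: "\<And>n x y z. \<lbrakk>x \<in> U (Suc n); y \<in> U (Suc n); z \<in> U (Suc n)\<rbrakk> \<Longrightarrow> x + y + z \<in> U n"
    by (metis old.nat.exhaust)
  define word where "word x ws \<longleftrightarrow> (\<forall>(k, u)\<in>set ws. u \<in> U k) \<and> (\<exists>a\<in>A. x = a + sum_list (map snd ws))"
    for x ws
  define f where "f x = Inf (insert 1 (weight ` Collect (word x)))" for x
  have bdd: "bdd_below (insert 1 (weight ` Collect (word x)))" for x
    by (rule bdd_belowI[of _ 0]) (auto simp: weight_nonneg)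
  have f01: "0 \<le> f x" "f x \<le> 1" for x
    unfolding f_def by (rule cInf_greatest, auto simp: weight_nonneg intro!: cInf_lower bdd)
  have f_le: "f x \<le> weight ws" if "word x ws" for x ws
    unfolding f_def by (rule cInf_lower) (use that bdd in auto)
  have step: "f (x + u) \<le> f x + (1/2)^n" if "u \<in> U n" for x u n
  proof -
    have "f (x + u) - (1/2)^n \<le> f x"
      unfolding f_def[of x]
    proof (rule cInf_greatest)
      fix t :: real
      assume "t \<in> insert 1 (weight ` Collect (word x))"
      then consider "t = 1" | ws where "word x ws" "t = weight ws"
        by auto
      then show "f (x + u) - (1/2)^n \<le> t"
      proof cases
        case 1
        then show ?thesis
          using f01(2)[of "x + u"] by (smt (verit) zero_le_power divide_nonneg_nonneg)
      next
        case 2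
        then have "word (x + u) (ws @ [(n, u)])"
          using that by (auto simp: word_def add.assoc)
        from f_le[OF this] show ?thesis
          using 2 by simp
      qed
    qed simp
    then show ?thesis
      by simp
  qed
  show thesis
  proof
    have "range f \<subseteq> {0..1}"
      using f01 by auto
    then show "bounded (range f)"
      by (rule bounded_subset[rotated]) simp
    show "uniformly_continuous_wrt left_uniformity f"
      unfolding uniformly_continuous_wrt_def filterlim_iff
    proof (intro allI impI)
      fix P :: "real \<times> real \<Rightarrow> bool"
      assume "eventually P uniformity"
      then obtain e where e: "e > 0" "\<And>s t. dist s t < e \<Longrightarrow> P (s, t)"
        by (auto simp: eventually_uniformity_metric)
      obtain n where n: "(1/2)^n < e"
        using real_arch_pow_inv[of e "1/2"] e(1) by auto
      show "\<forall>\<^sub>F p in left_uniformity. P (case p of (x, y) \<Rightarrow> (f x, f y))"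
        unfolding eventually_left_uniformity
      proof (intro exI[of _ "U n"] conjI allI impI)
        fix x y
        assume *: "- x + y \<in> U n"
        then have "- (- x + y) \<in> U n"
          using sym_nbhdD(3)[OF U(1)] by blast
        then have "f (y + (- y + x)) \<le> f y + (1/2)^n"
          by (intro step) (simp add: minus_add)
        moreover have "f (x + (- x + y)) \<le> f x + (1/2)^n"
          by (rule step[OF *])
        ultimately have "dist (f x) (f y) \<le> (1/2)^n"
          by (simp add: dist_real_def add.assoc[symmetric] abs_le_iff)
        then show "P (case (x, y) of (x, y) \<Rightarrow> (f x, f y))"
          using e(2) n by simp
      qed (rule sym_nbhdD(1)[OF U(1)])
    qed
    show "f a = 0" if "a \<in> A" for a
      using f_le[of a "[]"] f01(1)[of a] that by (simp add: word_def)
    show "\<exists>a\<in>A. - a + x \<in> W" if "f x < 1" for x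
    proof -
      have "\<exists>t\<in>insert 1 (weight ` Collect (word x)). t < 1"
        using that cInf_lessD[of "insert 1 (weight ` Collect (word x))" 1] unfolding f_def by auto
      then obtain ws where ws: "word x ws" "weight ws < 1"
        by auto
      then obtain a where a: "a \<in> A" "x = a + sum_list (map snd ws)" "\<forall>(k, u)\<in>set ws. u \<in> U k"
        by (auto simp: word_def)
      have "sum_list (map snd ws) \<in> U 0"
        by (rule word_mem[OF U(1) third]) (use a ws in auto)
      then show ?thesis
        using a(1,2) U(2) by (intro bexI[of _ a]) (auto simp: add.assoc[symmetric])
    qed
  qed
qed

text \<open>Right uniform continuity of the Urysohn function of \<open>A\<close>, with tolerance 1.
  Every later use of FSIN goes through this approximate invariance, for a suitably coded
  \<open>A\<close>.\<close>

lemma FSIN_translate: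
  fixes A W :: "'a::topological_group_add set"
  assumes FSIN: "FSIN TYPE('a)" and W: "\<forall>\<^sub>F u in nhds 0. u \<in> W"
  obtains V where "sym_nbhd V" "\<And>v a. v \<in> V \<Longrightarrow> a \<in> A \<Longrightarrow> \<exists>b\<in>A. - b + (v + a) \<in> W"
proof -
  obtain f :: "'a \<Rightarrow> real" where f: "bounded (range f)" "uniformly_continuous_wrt left_uniformity f"
    "\<And>a. a \<in> A \<Longrightarrow> f a = 0" "\<And>x. f x < 1 \<Longrightarrow> \<exists>a\<in>A. - a + x \<in> W"
    using left_uniform_Urysohn[OF W, of A] by blast
  then have "uniformly_continuous_wrt right_uniformity f"
    using FSIN by (auto simp: FSIN_def)
  moreover have "eventually (\<lambda>(s, t). dist s t < 1) (uniformity :: (real \<times> real) filter)"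
    by (auto simp: eventually_uniformity_metric intro: exI[of _ 1])
  ultimately have "\<forall>\<^sub>F p in right_uniformity. case (case p of (x, y) \<Rightarrow> (f x, f y)) of (s, t) \<Rightarrow> dist s t < 1"
    unfolding uniformly_continuous_wrt_def filterlim_iff by blast
  then obtain V where V: "\<forall>\<^sub>F u in nhds 0. u \<in> V" "\<And>x y. x - y \<in> V \<Longrightarrow> dist (f x) (f y) < 1"
    by (auto simp: eventually_right_uniformity)
  obtain V' where V': "sym_nbhd V'" "V' \<subseteq> V"
    using sym_nbhd_subset[OF V(1)] .
  show thesis
  proof (rule that[OF V'(1)])
    fix v a
    assume "v \<in> V'" "a \<in> A"
    then have "dist (f (v + a)) (f a) < 1"
      using V' by (intro V(2)) auto
    then show "\<exists>b\<in>A. - b + (v + a) \<in> W"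
      using f(3)[OF \<open>a \<in> A\<close>] by (intro f(4)) (auto simp: dist_real_def)
  qed
qed

subsection \<open>Balanced subsets and separated double cosets\<close>

text \<open>Subtraction is unfolded, so these are used with \<open>add_uminus_conv_diff\<close> deleted.\<close>
lemmas group_normalize = minus_add add.assoc diff_conv_add_uminus

text \<open>This is equicontinuity at \<open>0\<close> of the conjugations by elements of
  \<open>D\<close>.\<close>

definition balanced_on :: "'a::topological_group_add set \<Rightarrow> bool"
  where "balanced_on D \<longleftrightarrow> (\<forall>W. (\<forall>\<^sub>F u in nhds 0. u \<in> W) \<longrightarrow>
    (\<exists>V. sym_nbhd V \<and> (\<forall>d\<in>D. \<forall>v\<in>V. - d + (v + d) \<in> W)))"

lemma balanced_onE:
  assumes "balanced_on D" "\<forall>\<^sub>F u in nhds 0. u \<in> W"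
  obtains V where "sym_nbhd V" "\<And>d v. d \<in> D \<Longrightarrow> v \<in> V \<Longrightarrow> - d + (v + d) \<in> W"
  using assms by (auto simp: balanced_on_def)

lemma balanced_on_subset: "balanced_on D \<Longrightarrow> C \<subseteq> D \<Longrightarrow> balanced_on C"
  unfolding balanced_on_def by (meson subsetD)

text \<open>Conjugating by \<open>d + e\<close> means conjugating by \<open>d\<close>, then by
  \<open>e\<close>.\<close>

lemma balanced_on_add:
  assumes "balanced_on D" "balanced_on E" "\<And>c. c \<in> C \<Longrightarrow> \<exists>d\<in>D. \<exists>e\<in>E. c = d + e"
  shows "balanced_on C"
  unfolding balanced_on_def
proof (intro allI impI)
  fix W :: "'a set"
  assume "\<forall>\<^sub>F u in nhds 0. u \<in> W"
  then obtain V where V: "sym_nbhd V" "\<And>e v. e \<in> E \<Longrightarrow> v \<in> V \<Longrightarrow> - e + (v + e) \<in> W"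
    using balanced_onE[OF assms(2)] by blast
  obtain V' where V': "sym_nbhd V'" "\<And>d v. d \<in> D \<Longrightarrow> v \<in> V' \<Longrightarrow> - d + (v + d) \<in> V"
    using balanced_onE[OF assms(1) sym_nbhdD(1)[OF V(1)]] by blast
  have "- c + (v + c) \<in> W" if c: "c \<in> C" and v: "v \<in> V'" for c v
  proof -
    obtain d e where "d \<in> D" "e \<in> E" "c = d + e"
      using assms(3)[OF c] by blast
    then have "- e + ((- d + (v + d)) + e) \<in> W"
      using V(2) V'(2) v by blast
    then show ?thesis
      by (simp add: \<open>c = d + e\<close> group_normalize del: add_uminus_conv_diff)
  qed
  then show "\<exists>V. sym_nbhd V \<and> (\<forall>d\<in>C. \<forall>v\<in>V. - d + (v + d) \<in> W)"
    using V'(1) by blast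
qed

lemma SIN_if_balanced_on_UNIV:
  assumes "balanced_on (UNIV :: 'a::topological_group_add set)"
  shows "SIN TYPE('a)"
proof -
  have *: "\<exists>V. (\<forall>\<^sub>F u in nhds 0. u \<in> V) \<and> (\<forall>x y :: 'a. - x + y \<in> V \<longrightarrow> x - y \<in> U) \<and>
      (\<forall>x y. x - y \<in> V \<longrightarrow> - x + y \<in> U)"
    if U: "\<forall>\<^sub>F u in nhds 0. u \<in> U" for U :: "'a set"
  proof -
    obtain V where V: "sym_nbhd V" "\<And>d v :: 'a. v \<in> V \<Longrightarrow> - d + (v + d) \<in> U"
      using balanced_onE[OF assms U] by (metis UNIV_I)
    have "x - y \<in> U" if "- x + y \<in> V" for x y
    proof -
      \<comment> \<open>\<open>x - y\<close> is the conjugate of \<open>- (- x + y)\<close> by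
        \<open>- x\<close>; below, \<open>- x + y\<close> is the conjugate of
        \<open>- (x - y)\<close> by \<open>y\<close>.\<close>
      have "- (- x) + (- (- x + y) + (- x)) \<in> U"
        using V(2) sym_nbhdD(3)[OF V(1) that] by blast
      then show ?thesis
        by (simp add: group_normalize del: add_uminus_conv_diff)
    qed
    moreover have "- x + y \<in> U" if "x - y \<in> V" for x y
    proof -
      have "- y + (- (x - y) + y) \<in> U"
        using V(2) sym_nbhdD(3)[OF V(1) that] by blast
      then show ?thesis
        by (simp add: group_normalize del: add_uminus_conv_diff)
    qed
    ultimately show ?thesis
      using sym_nbhdD(1)[OF V(1)] by blast
  qed
  show ?thesis
    unfolding SIN_def filter_eq_iff eventually_left_uniformity eventually_right_uniformity
    using * by meson
qed

section \<open>Separated families are balanced\<close>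

text \<open>FSIN puts \<open>v + (p i + e i)\<close> close to some \<open>p k + e k\<close>, so
  \<open>e i\<close> lies in \<open>N + e k + N\<close> and separation forces \<open>k = i\<close>.
  The error is then exactly a conjugate of \<open>v\<close>.\<close>

lemma balanced_on_separated_family:
  fixes p e :: "'i \<Rightarrow> 'a::topological_group_add"
  assumes FSIN: "FSIN TYPE('a)" and "sym_nbhd N" "sym_nbhd P"
    and third: "\<And>x y z. \<lbrakk>x \<in> P; y \<in> P; z \<in> P\<rbrakk> \<Longrightarrow> x + y + z \<in> N"
    and p: "\<And>i. i \<in> I \<Longrightarrow> p i \<in> P"
    and sep: "\<And>i k x y. \<lbrakk>i \<in> I; k \<in> I; x \<in> N; y \<in> N; e i = x + e k + y\<rbrakk> \<Longrightarrow> i = k"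
  shows "balanced_on ((\<lambda>i. p i + e i) ` I)"
  unfolding balanced_on_def
proof (intro allI impI)
  fix W :: "'a set"
  assume "\<forall>\<^sub>F u in nhds 0. u \<in> W"
  then have "\<forall>\<^sub>F u in nhds 0. u \<in> W \<inter> N"
    using sym_nbhdD(1)[OF \<open>sym_nbhd N\<close>] by (auto intro: eventually_conj)
  then obtain V where V: "sym_nbhd V"
    and trans: "\<And>v a. v \<in> V \<Longrightarrow> a \<in> (\<lambda>i. p i + e i) ` I \<Longrightarrow>
      \<exists>b\<in>(\<lambda>i. p i + e i) ` I. - b + (v + a) \<in> W \<inter> N"
    using FSIN_translate[OF FSIN] by blast
  show "\<exists>V. sym_nbhd V \<and> (\<forall>d\<in>(\<lambda>i. p i + e i) ` I. \<forall>v\<in>V. - d + (v + d) \<in> W)"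
  \<comment> \<open>With \<open>v\<close> also in \<open>P\<close>, the left factor
    \<open>- p i + - v + p k\<close> is a sum of three elements of \<open>P\<close>; the right
    factor lies in \<open>N\<close> because \<open>W\<close> was cut down to
    \<open>W \<inter> N\<close>.\<close>
  proof (intro exI[of _ "V \<inter> P"] conjI ballI)
    fix d v
    assume "d \<in> (\<lambda>i. p i + e i) ` I" and v: "v \<in> V \<inter> P"
    then obtain i where i: "i \<in> I" "d = p i + e i"
      by blast
    obtain k where k: "k \<in> I" "- (p k + e k) + (v + (p i + e i)) \<in> W \<inter> N"
      using trans[of v d] v i by blast
    have "i = k"
    proof (rule sep[OF i(1) k(1)])
      show "- p i + - v + p k \<in> N"
        using v p[OF i(1)] p[OF k(1)] sym_nbhdD(3)[OF \<open>sym_nbhd P\<close>] by (intro third) auto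
      show "e i = (- p i + - v + p k) + e k + (- (p k + e k) + (v + (p i + e i)))"
        by (simp add: group_normalize del: add_uminus_conv_diff)
    qed (use k in blast)+
    then show "- d + (v + d) \<in> W"
      using k(2) i(2) by simp
  qed (rule sym_nbhd_Int[OF V \<open>sym_nbhd P\<close>])
qed

text \<open>Zorn's lemma: a point of \<open>Y\<close> unrelated to a maximal independent set could
  be inserted.\<close>

lemma maximal_independent_set:
  assumes refl: "\<And>x. x \<in> Y \<Longrightarrow> R x x" and sym: "\<And>x y. R x y \<Longrightarrow> R y x"
  shows "\<exists>M\<subseteq>Y. (\<forall>x\<in>M. \<forall>y\<in>M. R x y \<longrightarrow> x = y) \<and> (\<forall>y\<in>Y. \<exists>m\<in>M. R m y)"
proof -
  define \<A> where "\<A> = {M. M \<subseteq> Y \<and> (\<forall>x\<in>M. \<forall>y\<in>M. R x y \<longrightarrow> x = y)}"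
  have "\<exists>M\<in>\<A>. \<forall>X\<in>\<A>. M \<subseteq> X \<longrightarrow> X = M"
  proof (rule subset_Zorn')
    fix C
    assume C: "subset.chain \<A> C"
    then have "\<Union>C \<subseteq> Y"
      by (auto simp: subset_chain_def \<A>_def)
    moreover have "x = y" if "x \<in> X" "X \<in> C" "y \<in> Z" "Z \<in> C" "R x y" for x y X Z
    proof -
      have "X \<subseteq> Z \<or> Z \<subseteq> X"
        using C that by (auto simp: subset_chain_def)
      then have "(x \<in> Z \<and> y \<in> Z) \<or> (x \<in> X \<and> y \<in> X)"
        using that by blast
      moreover have "X \<in> \<A>" "Z \<in> \<A>"
        using C that by (auto simp: subset_chain_def)
      ultimately show ?thesis
        using that(5) unfolding \<A>_def by blast
    qed
    ultimately show "\<Union>C \<in> \<A>"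
      by (auto simp: \<A>_def)
  qed
  then obtain M where M: "M \<in> \<A>" "\<And>X. X \<in> \<A> \<Longrightarrow> M \<subseteq> X \<Longrightarrow> X = M"
    by blast
  have "\<exists>m\<in>M. R m y" if y: "y \<in> Y" for y
  proof (rule ccontr)
    assume *: "\<not> ?thesis"
    then have "insert y M \<in> \<A>"
      using M(1) y sym by (auto simp: \<A>_def)
    then have "insert y M = M"
      using M(2) by blast
    then show False
      using * refl[OF y] by blast
  qed
  moreover have "M \<subseteq> Y" "\<forall>x\<in>M. \<forall>y\<in>M. R x y \<longrightarrow> x = y"
    using M(1) by (auto simp: \<A>_def)
  ultimately show ?thesis
    by (intro exI[of _ M]) simp
qed

text \<open>No element lies in \<open>N + e' + N\<close> for another element \<open>e'\<close>;
  these sets themselves may still overlap.\<close>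

definition separated :: "'a::group_add set \<Rightarrow> 'a set \<Rightarrow> bool"
  where "separated N E \<longleftrightarrow> (\<forall>e\<in>E. \<forall>e'\<in>E. \<forall>x\<in>N. \<forall>y\<in>N. e = x + e' + y \<longrightarrow> e = e')"

lemma separatedD:
  "\<lbrakk>separated N E; e \<in> E; e' \<in> E; x \<in> N; y \<in> N; e = x + e' + y\<rbrakk> \<Longrightarrow> e = e'"
  unfolding separated_def by blast

lemma maximal_separated:
  assumes N: "sym_nbhd (N :: 'a::topological_group_add set)"
  shows "\<exists>E. separated N E \<and> (\<forall>g. \<exists>x\<in>N. \<exists>e\<in>E. \<exists>y\<in>N. g = x + e + y)"
proof -
  define R where "R e g \<longleftrightarrow> (\<exists>x\<in>N. \<exists>y\<in>N. g = x + e + y)" for e g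
  have "R g e" if eg: "R e g" for e g
  proof -
    obtain x y where "x \<in> N" "y \<in> N" "g = x + e + y"
      using eg unfolding R_def by blast
    moreover from this have "e = - x + g + - y"
      by (simp add: group_normalize del: add_uminus_conv_diff)
    ultimately show ?thesis
      using sym_nbhdD(3)[OF N] unfolding R_def by blast
  qed
  moreover have "R g g" for g
    using sym_nbhdD(2)[OF N] unfolding R_def by (intro bexI[of _ 0]) auto
  ultimately obtain E where E: "\<forall>e\<in>E. \<forall>e'\<in>E. R e e' \<longrightarrow> e = e'" "\<forall>g. \<exists>e\<in>E. R e g"
    using maximal_independent_set[of UNIV R] by auto
  have "separated N E"
    unfolding separated_def
  proof (intro ballI impI)
    fix e e' x y
    assume "e \<in> E" "e' \<in> E" "x \<in> N" "y \<in> N" "e = x + e' + y"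
    then show "e = e'"
      using E(1) unfolding R_def by metis
  qed
  moreover have "\<exists>x\<in>N. \<exists>e\<in>E. \<exists>y\<in>N. g = x + e + y" for g
    using E(2) unfolding R_def by blast
  ultimately show ?thesis
    by blast
qed

text \<open>The separated family with all \<open>p i = 0\<close>; symmetry of \<open>N\<close> makes
  the negatives separated too.\<close>

lemma balanced_on_separated:
  assumes FSIN: "FSIN TYPE('a::topological_group_add)" and N: "sym_nbhd (N :: 'a set)"
    and sep: "separated N E"
  shows "balanced_on E" "balanced_on (uminus ` E)"
proof -
  obtain P where P: "sym_nbhd P" "\<And>x y z. \<lbrakk>x \<in> P; y \<in> P; z \<in> P\<rbrakk> \<Longrightarrow> x + y + z \<in> N"
    using sym_nbhd_third[OF sym_nbhdD(1)[OF N]] by blast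
  have 0: "0 \<in> P"
    by (rule sym_nbhdD(2)[OF P(1)])
  have "balanced_on ((\<lambda>e. 0 + e) ` E)"
    by (rule balanced_on_separated_family[OF FSIN N P]) (use 0 sep in \<open>auto intro: separatedD\<close>)
  then show "balanced_on E"
    by simp
  have "balanced_on ((\<lambda>e. 0 + - e) ` E)"
  proof (rule balanced_on_separated_family[OF FSIN N P])
    fix e e' x y
    assume e: "e \<in> E" "e' \<in> E" "x \<in> N" "y \<in> N" "- e = x + - e' + y"
    have "e = - (x + - e' + y)"
      using e(5) by (metis minus_minus)
    then have "e = - y + e' + - x"
      by (simp add: group_normalize del: add_uminus_conv_diff)
    then show "e = e'"
      using separatedD[OF sep] e sym_nbhdD(3)[OF N] by blast
  qed (use 0 in auto)
  then show "balanced_on (uminus ` E)"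
    by simp
qed

text \<open>Write \<open>c = (c + j c) + (- j c)\<close>: the first summands form a separated family
  with perturbations \<open>c\<close>, the second are negatives of separated elements.\<close>

lemma balanced_on_small_inj_separated:
  assumes FSIN: "FSIN TYPE('a::topological_group_add)" and N: "sym_nbhd (N :: 'a set)"
    and sep: "separated N E" and P: "sym_nbhd P" "\<And>x y z. \<lbrakk>x \<in> P; y \<in> P; z \<in> P\<rbrakk> \<Longrightarrow> x + y + z \<in> N"
    and "C \<subseteq> P" and j: "inj_on j C" "j ` C \<subseteq> E"
  shows "balanced_on C"
proof (rule balanced_on_add[where D = "(\<lambda>c. c + j c) ` C" and E = "uminus ` E"])
  show "balanced_on ((\<lambda>c. c + j c) ` C)"
  proof (rule balanced_on_separated_family[OF FSIN N P, where p = "\<lambda>c. c" and e = j])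
    fix c c' x y
    assume *: "c \<in> C" "c' \<in> C" "x \<in> N" "y \<in> N" "j c = x + j c' + y"
    have "j c = j c'"
      by (rule separatedD[OF sep _ _ *(3-5)]) (use j(2) *(1,2) in auto)
    then show "c = c'"
      using j(1) \<open>c \<in> C\<close> \<open>c' \<in> C\<close> by (auto dest: inj_onD)
  qed (use \<open>C \<subseteq> P\<close> in auto)
  show "balanced_on (uminus ` E)"
    by (rule balanced_on_separated(2)[OF FSIN N sep])
  show "\<exists>d\<in>(\<lambda>c. c + j c) ` C. \<exists>e\<in>uminus ` E. c = d + e" if "c \<in> C" for c
    using that j(2) by (intro bexI[of _ "c + j c"] bexI[of _ "- j c"]) (auto simp: add.assoc)
qed

lemma balanced_on_inj_separated:
  assumes FSIN: "FSIN TYPE('a::topological_group_add)" and N: "sym_nbhd (N :: 'a set)"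
    and sep: "separated N E" and j: "inj_on j B" "j ` B \<subseteq> E"
  shows "balanced_on (B :: 'a set)"
proof -
  obtain P where P: "sym_nbhd P" "\<And>x y z. \<lbrakk>x \<in> P; y \<in> P; z \<in> P\<rbrakk> \<Longrightarrow> x + y + z \<in> N"
    using sym_nbhd_third[OF sym_nbhdD(1)[OF N]] by blast
  obtain D where D: "separated P D" "\<forall>g. \<exists>x\<in>P. \<exists>d\<in>D. \<exists>y\<in>P. g = x + d + y"
    using maximal_separated[OF P(1)] by blast
  obtain x d y where xdy: "\<And>g. x g \<in> P" "\<And>g. d g \<in> D" "\<And>g. y g \<in> P" "\<And>g. g = x g + d g + y g"
    using D(2) by metis
  have im: "balanced_on (f ` B)" if f: "\<And>g. f g \<in> P" for f
  proof (rule balanced_on_small_inj_separated[OF FSIN N sep P])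
    have inv: "inj_on (inv_into B f) (f ` B)" "inv_into B f ` f ` B \<subseteq> B"
      by (auto simp: inj_on_inv_into inv_into_into)
    then show "inj_on (j \<circ> inv_into B f) (f ` B)"
      using j(1) by (meson comp_inj_on inj_on_subset)
    show "(j \<circ> inv_into B f) ` f ` B \<subseteq> E"
      using inv j(2) by auto
  qed (use f in auto)
  have "balanced_on ((\<lambda>g. x g + d g) ` B)"
    by (rule balanced_on_add[OF im[of x, OF xdy(1)] balanced_on_separated(1)[OF FSIN P(1) D(1)]])
      (use xdy in blast)
  then show ?thesis
    by (rule balanced_on_add[OF _ im[of y, OF xdy(3)]]) (use xdy(4) in blast)
qed

section \<open>Rigidity of well-orders\<close>

text \<open>Each \<open>s v\<close> is a partial map with inverse \<open>s (i v)\<close>. Induct on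
  \<open>x\<close>: if \<open>y\<close> is below \<open>x\<close>, use the hypothesis for the
  inverse at \<open>y\<close>; if \<open>x\<close> is below \<open>y\<close>, the inverse sends
  \<open>y\<close> to \<open>x\<close> and \<open>x\<close> to some \<open>a\<close> strictly below
  \<open>x\<close>, which \<open>s v\<close> moves back to \<open>x\<close>.\<close>

lemma well_order_automorphisms_trivial:
  assumes r: "well_order_on Y r"
    and uniq: "\<And>v x y z. \<lbrakk>v \<in> V; s v x y; s v x z\<rbrakk> \<Longrightarrow> y = z"
    and inv: "\<And>v. v \<in> V \<Longrightarrow> i v \<in> V" "\<And>v x y. \<lbrakk>v \<in> V; s v x y\<rbrakk> \<Longrightarrow> s (i v) y x"
      "\<And>v x y. \<lbrakk>v \<in> V; s (i v) y x\<rbrakk> \<Longrightarrow> s v x y"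
    and mono: "\<And>v x y. \<lbrakk>v \<in> V; (x, y) \<in> r\<rbrakk> \<Longrightarrow> \<exists>x' y'. (x', y') \<in> r \<and> s v x x' \<and> s v y y'"
  shows "\<lbrakk>v \<in> V; x \<in> Y; y \<in> Y; s v x y\<rbrakk> \<Longrightarrow> x = y"
proof -
  have wf: "wf (r - Id)" and tot: "total_on Y r" and rY: "r \<subseteq> Y \<times> Y"
    using r by (auto simp: well_order_on_def linear_order_on_def partial_order_on_def
        preorder_on_def refl_on_def)
  have "\<forall>v\<in>V. \<forall>y\<in>Y. x \<in> Y \<longrightarrow> s v x y \<longrightarrow> x = y" for x
    using wf
  proof (induction x rule: wf_induct_rule)
    case (less x)
    show ?case
    proof (intro ballI impI, rule ccontr)
      fix v y
      assume v: "v \<in> V" and xy: "x \<in> Y" "y \<in> Y" "s v x y" "x \<noteq> y"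
      then have s: "s (i v) y x"
        using inv by blast
      consider "(y, x) \<in> r" | "(x, y) \<in> r"
        using tot xy by (auto simp: total_on_def)
      then show False
      proof cases
        case 1
        then show False
          using less.IH[of y] inv(1)[OF v] xy s by auto
      next
        case 2
        then obtain a b where ab: "(a, b) \<in> r" "s (i v) x a" "s (i v) y b"
          using mono inv(1)[OF v] by blast
        then have "b = x"
          using uniq[OF inv(1)[OF v]] s by blast
        moreover have "a \<noteq> x"
          using uniq[OF v] inv(3)[OF v] ab(2) xy by blast
        ultimately show False
          using less.IH[of a] v ab inv(3)[OF v ab(2)] xy(1) rY by auto
      qed
    qed
  qed
  then show "\<lbrakk>v \<in> V; x \<in> Y; y \<in> Y; s v x y\<rbrakk> \<Longrightarrow> x = y"
    by blast
qed

subsection \<open>Invariant relations\<close>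

text \<open>With \<open>- p + p' = a + b + c\<close>, the pair is coded by the one element
  \<open>p + a - h b\<close>. Translating codes preserves \<open>b\<close>, and the errors at both
  coordinates can be read off.\<close>

lemma translate_pairs:
  assumes FSIN: "FSIN TYPE('a::topological_group_add)"
    and P: "sym_nbhd (P :: 'a set)" "\<And>x y z. \<lbrakk>x \<in> P; y \<in> P; z \<in> P\<rbrakk> \<Longrightarrow> x + y + z \<in> P2"
    and P2: "\<And>x y z. \<lbrakk>x \<in> P2; y \<in> P2; z \<in> P2\<rbrakk> \<Longrightarrow> x + y + z \<in> P1"
    and Q: "sym_nbhd Q" "Q \<subseteq> P" "\<And>x y z. \<lbrakk>x \<in> Q; y \<in> Q; z \<in> Q\<rbrakk> \<Longrightarrow> x + y + z \<in> T"
    and F: "balanced_on F" "\<forall>g. \<exists>x\<in>Q. \<exists>f\<in>F. \<exists>y\<in>Q. g = x + f + y"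
    and h: "inj_on h F" "balanced_on (h ` F)"
      "\<And>f f'. \<lbrakk>f \<in> F; f' \<in> F; - h f' + h f \<in> P1\<rbrakk> \<Longrightarrow> h f = h f'"
    and R: "R \<subseteq> P \<times> P"
  obtains V where "sym_nbhd V" "\<And>v p p'. \<lbrakk>v \<in> V; (p, p') \<in> R\<rbrakk> \<Longrightarrow>
    \<exists>p1 p1'. (p1, p1') \<in> R \<and> - p1 + (v + p) \<in> T \<and> - p1' + (v + p') \<in> T"
proof -
  have hF: "balanced_on ((\<lambda>f. h f + f) ` F)"
    by (rule balanced_on_add[OF h(2) F(1)]) blast
  \<comment> \<open>The code error \<open>u\<close> will be conjugated by \<open>h b\<close>, and
    the result by \<open>b\<close>; the latter amounts to conjugating by
    \<open>h b + b\<close>.\<close>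
  obtain U1 where U1: "sym_nbhd U1" "\<And>d u. d \<in> h ` F \<Longrightarrow> u \<in> U1 \<Longrightarrow> - d + (u + d) \<in> Q"
    using balanced_onE[OF h(2) sym_nbhdD(1)[OF Q(1)]] by blast
  obtain U2 where U2: "sym_nbhd U2" "\<And>d u. d \<in> (\<lambda>f. h f + f) ` F \<Longrightarrow> u \<in> U2 \<Longrightarrow> - d + (u + d) \<in> Q"
    using balanced_onE[OF hF sym_nbhdD(1)[OF Q(1)]] by blast
  have U: "sym_nbhd (U1 \<inter> U2)"
    by (rule sym_nbhd_Int[OF U1(1) U2(1)])
  obtain q f q' where qf: "\<And>g. q g \<in> Q" "\<And>g. f g \<in> F" "\<And>g. q' g \<in> Q" "\<And>g. g = q g + f g + q' g"
    using F(2) by metis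
  define S where "S = (\<lambda>(p, p'). p + q (- p + p') - h (f (- p + p'))) ` R"
  obtain V where V: "sym_nbhd V" "\<And>v a. v \<in> V \<Longrightarrow> a \<in> S \<Longrightarrow> \<exists>b\<in>S. - b + (v + a) \<in> U1 \<inter> U2"
    using FSIN_translate[OF FSIN sym_nbhdD(1)[OF U], of S] by blast
  show thesis
  proof (rule that[OF sym_nbhd_Int[OF V(1) P(1)]])
    fix v p p'
    assume v: "v \<in> V \<inter> P" and pp: "(p, p') \<in> R"
    define a b c where abc: "a = q (- p + p')" "b = f (- p + p')" "c = q' (- p + p')"
    have "- p + p' = a + b + c"
      unfolding abc by (rule qf(4))
    then have "p + (a + b + c) = p'"
      by (metis add_minus_cancel)
    then have a: "a \<in> Q" "b \<in> F" "c \<in> Q" "p' = p + (a + b + c)"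
      using qf(1-3) unfolding abc by auto
    have "p + a - h b \<in> S"
      unfolding S_def using pp by (auto simp: abc intro!: rev_image_eqI)
    then obtain s where "s \<in> S" and s: "- s + (v + (p + a - h b)) \<in> U1 \<inter> U2"
      using V(2) v by blast
    then obtain p1 p1' where pp1: "(p1, p1') \<in> R"
      "s = p1 + q (- p1 + p1') - h (f (- p1 + p1'))"
      by (auto simp: S_def)
    define a1 b1 c1 where abc1: "a1 = q (- p1 + p1')" "b1 = f (- p1 + p1')" "c1 = q' (- p1 + p1')"
    have "- p1 + p1' = a1 + b1 + c1"
      unfolding abc1 by (rule qf(4))
    then have "p1 + (a1 + b1 + c1) = p1'"
      by (metis add_minus_cancel)
    then have a1: "a1 \<in> Q" "b1 \<in> F" "c1 \<in> Q" "p1' = p1 + (a1 + b1 + c1)"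
      using qf(1-3) unfolding abc1 by auto
    define u where "u = - (p1 + a1 - h b1) + (v + (p + a - h b))"
    have u: "u \<in> U1" "u \<in> U2"
      using s by (simp_all add: u_def pp1(2) abc1)
    have vp: "v + (p + a) = p1 + a1 + (- h b1 + u + h b)"
      unfolding u_def by (simp add: group_normalize del: add_uminus_conv_diff)
    have inP: "p \<in> P" "p1 \<in> P" "a \<in> P" "a1 \<in> P" "v \<in> P" "0 \<in> P"
      using R pp pp1(1) a a1 Q(2) v sym_nbhdD(2)[OF P(1)] by auto
    \<comment> \<open>\<open>- h b1 + h b\<close> splits into a conjugate of \<open>- u\<close> and
      two short sums over \<open>P\<close>, so it lies in \<open>P1\<close>, where distinct values
      of \<open>h\<close> cannot differ.\<close>
    have "h b = h b1"
    proof (rule h(3)[OF a(2) a1(2)])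
      have "- h b1 + (- u + h b1) \<in> Q"
        using U1(2)[of "h b1" "- u"] a1(2) u(1) sym_nbhdD(3)[OF U1(1)] by blast
      then have "- h b1 + (- u + h b1) + 0 + 0 \<in> P2"
        using Q(2) inP(6) by (intro P(2)) auto
      moreover have "- a1 + - p1 + v \<in> P2" "p + a + 0 \<in> P2"
        by (intro P(2) inP sym_nbhdD(3)[OF P(1)])+
      ultimately have "(- h b1 + (- u + h b1) + 0 + 0) + (- a1 + - p1 + v) + (p + a + 0) \<in> P1"
        by (rule P2)
      moreover have "(- h b1 + (- u + h b1) + 0 + 0) + (- a1 + - p1 + v) + (p + a + 0) = - h b1 + h b"
        unfolding u_def by (simp add: group_normalize del: add_uminus_conv_diff)
      ultimately show "- h b1 + h b \<in> P1"
        by simp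
    qed
    then have b: "b1 = b"
      using h(1) a(2) a1(2) by (auto dest: inj_onD)
    define t where "t = - h b + (u + h b)"
    have t: "t \<in> Q" "- b + (t + b) \<in> Q"
      using U1(2)[of "h b" u] U2(2)[of "h b + b" u] a(2) u
      by (auto simp: t_def group_normalize simp del: add_uminus_conv_diff)
    have "v + p = p1 + a1 + t + - a"
      using vp unfolding b t_def
      by (metis add.assoc add.right_neutral add.right_inverse)
    then have "- p1 + (v + p) = a1 + t + - a"
      by (simp add: group_normalize del: add_uminus_conv_diff)
    moreover have "v + p' = p1 + a1 + t + b + c"
    proof -
      have "v + p' = (v + (p + a)) + b + c"
        by (simp add: a(4) add.assoc)
      then show ?thesis
        unfolding vp b t_def by (simp add: add.assoc)
    qed
    then have "- p1' + (v + p') = - c1 + (- b + (t + b)) + c"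
      by (simp add: a1(4) b group_normalize del: add_uminus_conv_diff)
    ultimately have "- p1 + (v + p) \<in> T" "- p1' + (v + p') \<in> T"
      using Q(3)[of a1 t "- a"] Q(3)[of "- c1" "- b + (t + b)" c] a a1 t sym_nbhdD(3)[OF Q(1)] by auto
    then show "\<exists>p1 p1'. (p1, p1') \<in> R \<and> - p1 + (v + p) \<in> T \<and> - p1' + (v + p') \<in> T"
      using pp1(1) by blast
  qed
qed

text \<open>Apply the invariance of relations to a well-order of a maximal
  \<open>T1\<close>-discrete set \<open>Y\<close> in \<open>P\<close>: approximate translations
  become partial automorphisms, hence are trivial.\<close>

lemma balanced_on_nbhd:
  assumes FSIN: "FSIN TYPE('a::topological_group_add)"
    and P: "sym_nbhd (P :: 'a set)" "\<And>x y z. \<lbrakk>x \<in> P; y \<in> P; z \<in> P\<rbrakk> \<Longrightarrow> x + y + z \<in> P2"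
    and P2: "\<And>x y z. \<lbrakk>x \<in> P2; y \<in> P2; z \<in> P2\<rbrakk> \<Longrightarrow> x + y + z \<in> P1"
    and M: "\<forall>m\<in>M. \<forall>m'\<in>M. - m + m' \<in> P1 \<longrightarrow> m = m'"
    and h: "\<And>Q F :: 'a set. \<lbrakk>sym_nbhd Q; separated Q F\<rbrakk> \<Longrightarrow> \<exists>h. inj_on h F \<and> h ` F \<subseteq> M \<and> balanced_on (h ` F)"
  shows "balanced_on P"
  unfolding balanced_on_def
proof (intro allI impI)
  fix W :: "'a set"
  assume W: "\<forall>\<^sub>F u in nhds 0. u \<in> W"
  obtain T1 where T1: "sym_nbhd T1" "\<And>x y z. \<lbrakk>x \<in> T1; y \<in> T1; z \<in> T1\<rbrakk> \<Longrightarrow> x + y + z \<in> W"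
    using sym_nbhd_third[OF W] by blast
  obtain T2 where T2: "sym_nbhd T2" "\<And>x y z. \<lbrakk>x \<in> T2; y \<in> T2; z \<in> T2\<rbrakk> \<Longrightarrow> x + y + z \<in> T1"
    using sym_nbhd_third[OF sym_nbhdD(1)[OF T1(1)]] by blast
  obtain Q where Q: "sym_nbhd Q" "\<And>x y z. \<lbrakk>x \<in> Q; y \<in> Q; z \<in> Q\<rbrakk> \<Longrightarrow> x + y + z \<in> T2"
    using sym_nbhd_third[OF sym_nbhdD(1)[OF T2(1)]] by blast
  define Q' where "Q' = Q \<inter> P"
  have Q': "sym_nbhd Q'" "Q' \<subseteq> P" "\<And>x y z. \<lbrakk>x \<in> Q'; y \<in> Q'; z \<in> Q'\<rbrakk> \<Longrightarrow> x + y + z \<in> T2"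
    using sym_nbhd_Int[OF Q(1) P(1)] Q(2) by (auto simp: Q'_def)
  obtain F where F: "separated Q' F" "\<forall>g. \<exists>x\<in>Q'. \<exists>f\<in>F. \<exists>y\<in>Q'. g = x + f + y"
    using maximal_separated[OF Q'(1)] by blast
  obtain h where h': "inj_on h F" "h ` F \<subseteq> M" "balanced_on (h ` F)"
    using h[OF Q'(1) F(1)] by blast
  have "\<exists>Y\<subseteq>P. (\<forall>x\<in>Y. \<forall>y\<in>Y. - x + y \<in> T1 \<longrightarrow> x = y) \<and> (\<forall>y\<in>P. \<exists>m\<in>Y. - m + y \<in> T1)"
  proof (rule maximal_independent_set)
    show "- y + x \<in> T1" if "- x + y \<in> T1" for x y
      using sym_nbhdD(3)[OF T1(1) that] by (simp add: group_normalize del: add_uminus_conv_diff)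
  qed (use sym_nbhdD(2)[OF T1(1)] in simp)
  then obtain Y where Y: "Y \<subseteq> P" "\<forall>x\<in>Y. \<forall>y\<in>Y. - x + y \<in> T1 \<longrightarrow> x = y"
    "\<forall>p\<in>P. \<exists>y\<in>Y. - y + p \<in> T1"
    by (elim exE conjE)
  obtain r where r: "well_order_on Y r"
    using well_order_on by blast
  then have rY: "r \<subseteq> Y \<times> Y" and refl: "y \<in> Y \<Longrightarrow> (y, y) \<in> r" for y
    by (auto simp: well_order_on_def linear_order_on_def partial_order_on_def
        preorder_on_def refl_on_def)
  obtain V where V: "sym_nbhd V" "\<And>v p p'. \<lbrakk>v \<in> V; (p, p') \<in> r\<rbrakk> \<Longrightarrow>
    \<exists>p1 p1'. (p1, p1') \<in> r \<and> - p1 + (v + p) \<in> T2 \<and> - p1' + (v + p') \<in> T2"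
  proof (rule translate_pairs[OF FSIN P P2 Q' balanced_on_separated(1)[OF FSIN Q'(1) F(1)] F(2) h'(1,3)])
    show "h f = h f'" if "f \<in> F" "f' \<in> F" "- h f' + h f \<in> P1" for f f'
      using that h'(2) M by (metis image_subset_iff)
    show "r \<subseteq> P \<times> P"
      using rY Y(1) by blast
  qed (assumption | blast)+
  define s where "s v x y \<longleftrightarrow> x \<in> Y \<and> y \<in> Y \<and> - y + (v + x) \<in> T2" for v x y
  \<comment> \<open>Two \<open>T2\<close>-approximations to the same translate differ by an element
    of \<open>T1\<close>, so discreteness of \<open>Y\<close> identifies them.\<close>
  have uniq: "y = z" if "s v x y" "s v x z" for v x y z
  proof (rule Y(2)[rule_format])
    have "- (- z + (v + x)) \<in> T2"
      using that sym_nbhdD(3)[OF T2(1)] unfolding s_def by blast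
    moreover have "- y + (v + x) \<in> T2" "0 \<in> T2"
      using that sym_nbhdD(2)[OF T2(1)] unfolding s_def by auto
    ultimately have "(- y + (v + x)) + (- (- z + (v + x))) + 0 \<in> T1"
      by (intro T2(2))
    then show "- y + z \<in> T1"
      by (simp add: group_normalize del: add_uminus_conv_diff)
  qed (use that in \<open>auto simp: s_def\<close>)
  have inv: "s (- v) y x" if "s v x y" for v x y
  proof -
    have "- (- y + (v + x)) \<in> T2"
      using that sym_nbhdD(3)[OF T2(1)] unfolding s_def by blast
    then show ?thesis
      using that by (simp add: s_def group_normalize del: add_uminus_conv_diff)
  qed
  have triv: "x = y" if "v \<in> V" "s v x y" for v x y
  proof (rule well_order_automorphisms_trivial[OF r, where s = s and V = V and i = uminus])
    show "\<exists>x' y'. (x', y') \<in> r \<and> s v x x' \<and> s v y y'" if "v \<in> V" "(x, y) \<in> r" for v x y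
      using V(2)[OF that] rY that(2) unfolding s_def by blast
    show "s v x y" if "s (- v) y x" for v x y
      using inv[OF that] by simp
  qed (use that uniq inv sym_nbhdD(3)[OF V(1)] in \<open>auto simp: s_def\<close>)
  have "- p + (v + p) \<in> W" if p: "p \<in> P" and v: "v \<in> V" for p v
  proof -
    obtain y where y: "y \<in> Y" "- y + p \<in> T1"
      using Y(3) p by blast
    \<comment> \<open>The reflexive pair \<open>(y, y)\<close> shows that \<open>s v\<close> is
      defined at \<open>y\<close>.\<close>
    obtain y' where "s v y y'"
      using V(2)[OF v refl[OF y(1)]] rY y(1) unfolding s_def by blast
    then have "- y + (v + y) \<in> T2"
      using triv[OF v] by (auto simp: s_def)
    then have "- y + (v + y) \<in> T1"
      using T2(2)[of "- y + (v + y)" 0 0] sym_nbhdD(2)[OF T2(1)] by simp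
    then have "- (- y + p) + (- y + (v + y)) + (- y + p) \<in> W"
      using y(2) sym_nbhdD(3)[OF T1(1)] by (intro T1(2))
    then show ?thesis
      by (simp add: group_normalize del: add_uminus_conv_diff)
  qed
  then show "\<exists>V. sym_nbhd V \<and> (\<forall>d\<in>P. \<forall>v\<in>V. - d + (v + d) \<in> W)"
    using V(1) by blast
qed

section \<open>The minimal cardinality argument\<close>

lemma balanced_on_UNIV_if_FSIN:
  assumes FSIN: "FSIN TYPE('a::topological_group_add)"
  shows "balanced_on (UNIV :: 'a set)"
proof (rule ccontr)
  assume unb: "\<not> ?thesis"
  obtain O1 :: "'a set" where O1: "\<forall>\<^sub>F u in nhds 0. u \<in> O1"
    "\<And>V. sym_nbhd V \<Longrightarrow> \<exists>g. \<exists>v\<in>V. - g + (v + g) \<notin> O1"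
    using unb unfolding balanced_on_def by auto
  obtain P1 where P1: "sym_nbhd P1" "\<And>x y z. \<lbrakk>x \<in> P1; y \<in> P1; z \<in> P1\<rbrakk> \<Longrightarrow> x + y + z \<in> O1"
    using sym_nbhd_third[OF O1(1)] by blast
  obtain P2 where P2: "sym_nbhd P2" "\<And>x y z. \<lbrakk>x \<in> P2; y \<in> P2; z \<in> P2\<rbrakk> \<Longrightarrow> x + y + z \<in> P1"
    using sym_nbhd_third[OF sym_nbhdD(1)[OF P1(1)]] by blast
  obtain P where P: "sym_nbhd P" "\<And>x y z. \<lbrakk>x \<in> P; y \<in> P; z \<in> P\<rbrakk> \<Longrightarrow> x + y + z \<in> P2"
    using sym_nbhd_third[OF sym_nbhdD(1)[OF P2(1)]] by blast
  have "\<exists>M\<subseteq>UNIV. (\<forall>x\<in>M. \<forall>y\<in>M. - x + y \<in> P1 \<longrightarrow> x = y) \<and> (\<forall>y\<in>UNIV. \<exists>m\<in>M. - m + y \<in> P1)"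
  proof (rule maximal_independent_set)
    show "- y + x \<in> P1" if "- x + y \<in> P1" for x y
      using sym_nbhdD(3)[OF P1(1) that] by (simp add: group_normalize del: add_uminus_conv_diff)
  qed (use sym_nbhdD(2)[OF P1(1)] in simp)
  then obtain M where M: "\<forall>x\<in>M. \<forall>y\<in>M. - x + y \<in> P1 \<longrightarrow> x = y"
    "\<forall>g\<in>UNIV. \<exists>m\<in>M. - m + g \<in> P1"
    by (elim exE conjE)
  have wf: "wf (inv_image ordLess (card_of :: 'a set \<Rightarrow> 'a rel))"
    by (rule wf_inv_image[OF wf_ordLess])
  have "\<exists>B::'a set. \<not> balanced_on B \<and> (\<forall>D::'a set. (card_of D, card_of B) \<in> ordLess \<longrightarrow> balanced_on D)"
  proof (rule ccontr)
    assume *: "\<not> ?thesis"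
    have "balanced_on D" for D :: "'a set"
      using wf
    proof (induction D rule: wf_induct_rule)
      case (less D)
      then show ?case
        using * unfolding in_inv_image by blast
    qed
    then show False
      using unb by blast
  qed
  then obtain B :: "'a set" where B: "\<not> balanced_on B"
    "\<forall>D::'a set. (card_of D, card_of B) \<in> ordLess \<longrightarrow> balanced_on D"
    by blast
  \<comment> \<open>Otherwise \<open>B\<close> would inject into the separated set \<open>F\<close>
    and be balanced.\<close>
  have less: "(card_of F, card_of B) \<in> ordLess" if "sym_nbhd Q" "separated Q F" for Q F :: "'a set"
  proof (rule ccontr)
    assume "\<not> ?thesis"
    then have "(card_of B, card_of F) \<in> ordLeq"
      by (simp add: card_of_Well_order not_ordLess_iff_ordLeq)
    then obtain j where "inj_on j B" "j ` B \<subseteq> F"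
      by (auto simp: card_of_ordLeq[symmetric])
    then show False
      using balanced_on_inj_separated[OF FSIN that] B(1) by blast
  qed
  \<comment> \<open>Every \<open>g\<close> is \<open>m\<close> plus an element of \<open>P1\<close>,
    so balance of \<open>M\<close> would put conjugates by all \<open>g\<close> into
    \<open>O1\<close>, against the choice of \<open>O1\<close>.\<close>
  have "\<not> balanced_on M"
  proof
    assume "balanced_on M"
    then obtain V where V: "sym_nbhd V" "\<And>m v. m \<in> M \<Longrightarrow> v \<in> V \<Longrightarrow> - m + (v + m) \<in> P1"
      using balanced_onE sym_nbhdD(1)[OF P1(1)] by blast
    have "- g + (v + g) \<in> O1" if "v \<in> V" for g v
    proof -
      obtain m where m: "m \<in> M" "- m + g \<in> P1"
        using M(2) by blast
      then have "- (- m + g) + (- m + (v + m)) + (- m + g) \<in> O1"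
        using V(2) that sym_nbhdD(3)[OF P1(1)] by (intro P1(2)) auto
      then show ?thesis
        by (simp add: group_normalize del: add_uminus_conv_diff)
    qed
    then show False
      using O1(2)[OF V(1)] by blast
  qed
  then have BM: "(card_of B, card_of M) \<in> ordLeq"
    using B(2) by (metis card_of_Well_order not_ordLess_iff_ordLeq)
  have bP: "balanced_on P"
  proof (rule balanced_on_nbhd[OF FSIN P P2(2)])
    fix Q F :: "'a set"
    assume "sym_nbhd Q" "separated Q F"
    then have FB: "(card_of F, card_of B) \<in> ordLess"
      by (rule less)
    then have "(card_of F, card_of M) \<in> ordLeq"
      using BM by (rule ordLess_ordLeq_trans[THEN ordLess_imp_ordLeq])
    then obtain h where h: "inj_on h F" "h ` F \<subseteq> M"
      by (auto simp: card_of_ordLeq[symmetric])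
    \<comment> \<open>The image is still smaller than \<open>B\<close>, so minimality of
      \<open>B\<close> makes it balanced.\<close>
    moreover have "(card_of (h ` F), card_of B) \<in> ordLess"
      using card_of_image FB by (rule ordLeq_ordLess_trans)
    ultimately show "\<exists>h. inj_on h F \<and> h ` F \<subseteq> M \<and> balanced_on (h ` F)"
      using B(2) by blast
  qed (assumption | rule M(1))+
  obtain D where D: "separated P D" "\<forall>g. \<exists>x\<in>P. \<exists>d\<in>D. \<exists>y\<in>P. g = x + d + y"
    using maximal_separated[OF P(1)] by blast
  have "balanced_on {x + d | x d. x \<in> P \<and> d \<in> D}"
    by (rule balanced_on_add[OF bP balanced_on_separated(1)[OF FSIN P(1) D(1)]]) blast
  then have "balanced_on (UNIV :: 'a set)"
    by (rule balanced_on_add[OF _ bP]) (use D(2) in blast)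
  then show False
    using unb by blast
qed

theorem theorem1p3:
  assumes "FSIN TYPE('a::{topological_group_add, t2_space})"
  shows "SIN TYPE('a)"
  by (rule SIN_if_balanced_on_UNIV[OF balanced_on_UNIV_if_FSIN[OF assms]])

end
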